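(* Let $f:\mathbb{R}^n\to\mathbb{R}$ be differentiable with $\|\nabla f(x)-\nabla f(y)\|\le L\|x-y\|$ for all $x,y\in\mathbb{R}^n$, where $L>0$, and let $f$ be $\lambda$-strongly convex for some $\lambda>0$, i.e. $f(y)\ge f(x)+\langle\nabla f(x),y-x\rangle+\frac\lambda2\|y-x\|^2$ for all $x,y\in\mathbb{R}^n$. Let $x_*$ be the minimizer of $f$. Let $D\subset\mathbb{R}^n$ be a finite set of unit-norm vectors forming a positive spanning set, with cosine measure $\mu$. Let $x_0\in\mathbb{R}^n$, $\alpha_0>0$, $c>0$ satisfy $$f(x_0+\alpha_0 d)>f(x_0)-c\alpha_0^2\quad\text{for all } d\in D.$$ Put $S=\frac{(\frac L2+c)^2}{2\lambda\mu^2}$. Then: (i) The iterates $\{x_k\}_{k\ge0}$ of Simplified Direct Search (SDS) with input $(x_0,\alpha_0,c,D)$ satisfy $$\|\nabla f(x_k)\|\le\frac{(\frac L2+c)\alpha_0}{2^k\mu},\qquad f(x_k)-f(x_* )\le S\left(\frac{\alpha_0}{2^k}\right)^2,\qquad \|x_k-x_*\|\le\frac{(\frac L2+c)\alpha_0}{2^k\mu\lambda},$$ where at each iteration the method needs to perform at most $|D|\left(\frac{4S}{c}+1\right)$ function evaluations. (ii) In particular, if $0<\epsilon<S\alpha_0^2$ and $k=k(\epsilon)=\left\lceil\log_2\left(\alpha_0\sqrt{\frac S\epsilon}\right)\right\rceil$, then $f(x_k)-f(x_* )\le\epsilon$, while the method performs, up to iteration $k(\epsilon)$, in total at most $N(k(\epsilon))$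 function evaluations, where $$N(k(\epsilon))\le1+|D|\left(\frac{4S}{c}+1\right)\left(1+\log_2\left(\alpha_0\sqrt{\frac S\epsilon}\right)\right).$$
   Context: $\langle\cdot,\cdot\rangle$ and $\|\cdot\|$ are the standard Euclidean inner product and norm on $\mathbb{R}^n$. A finite set $D\subset\mathbb{R}^n$ is a positive spanning set if its conic hull $\{\sum_i t_i d_i: d_i\in D,\ t_i\ge 0\}$ equals $\mathbb{R}^n$. The cosine measure of $D$ is $\mu=\min_{0\ne v\in\mathbb{R}^n}\max_{d\in D}\frac{\langle v,d\rangle}{\|v\|\|d\|}$; it is positive for a positive spanning set of nonzero vectors. Simplified Direct Search (SDS). Input: $x_0\in\mathbb{R}^n$, $\alpha_0>0$, forcing constant $c>0$, finite set $D\subset\mathbb{R}^n$. For $k=1,2,\dots$: set $x_k^0=x_{k-1}$ and $\alpha_k=\frac12\alpha_{k-1}$ (so $\alpha_k=\alpha_0/2^k$); starting from $l=0$, while there exists $d\in D$ with $f(x_k^l+\alpha_k d)\le f(x_k^l)-c\alpha_k^2$, pick any such $d$, call it $d_k^l$, set $x_k^{l+1}=x_k^l+\alpha_k d_k^l$ and increase $l$ by one. Let $l_k$ be the value of $l$ when this inner loop stops (i.e. $f(x_k^{l_k}+\alpha_k d)>f(x_k^{l_k})-c\alpha_k^2$ for all $d\in D$), and set $x_k=x_k^{l_k}$. The choice of $d$ among those satisfying the decrease condition is arbitrary, and the statement holds for every such choice. Cost model: computing $f(x_0)$ costs one evaluation; given the value of $f$ at the current point, finding a direction satisfying the decrease condition,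 or verifying that there is none, costs at most $|D|$ evaluations. Thus iteration $j\ge1$ costs at most $|D|(l_j+1)$ evaluations, and the total up to iteration $k$ is at most $N(k)=1+\sum_{j=1}^k|D|(l_j+1)$. The per-iteration bound in (i) is a bound on $|D|(l_k+1)$, $k\ge1$. *)

theory Defs
  imports "HOL-Analysis.Analysis"
begin

definition positive_spanning_set :: "'a::euclidean_space set \<Rightarrow> bool" where
  "positive_spanning_set D \<longleftrightarrow>
     finite D \<and> {\<Sum>d\<in>D. t d *\<^sub>R d | t. \<forall>d\<in>D. (t d :: real) \<ge> 0} = UNIV"

text \<open>
  The infimum over nonzero vectors is attained for every finite nonempty \<open>D\<close>,
  see \<open>cosine_measure_is_minimum\<close> below.
\<close>

definition cosine_measure :: "'a::euclidean_space set \<Rightarrow> real" where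
  "cosine_measure D = (INF v\<in>-{0}. Max ((\<lambda>d. (v \<bullet> d) / (norm v * norm d)) ` D))"

lemma continuous_on_Max_image:
  fixes g :: "'b \<Rightarrow> 'a::topological_space \<Rightarrow> real"
  assumes "finite D" "D \<noteq> {}" "\<And>d. d \<in> D \<Longrightarrow> continuous_on A (g d)"
  shows "continuous_on A (\<lambda>v. Max ((\<lambda>d. g d v) ` D))"
  using assms by (induction D rule: finite_ne_induct) (auto intro!: continuous_on_max)

lemma cosine_measure_is_minimum:
  fixes D :: "'a::euclidean_space set"
  assumes "finite D" "D \<noteq> {}"
  obtains v where "v \<noteq> 0"
    and "cosine_measure D = Max ((\<lambda>d. (v \<bullet> d) / (norm v * norm d)) ` D)"
    and "\<And>w. w \<noteq> 0 \<Longrightarrow> cosine_measure D \<le> Max ((\<lambda>d. (w \<bullet> d) / (norm w * norm d)) ` D)"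
proof -
  define g where "g = (\<lambda>v. Max ((\<lambda>d. (v \<bullet> d) / (norm v * norm d)) ` D))"
  have "continuous_on (sphere 0 1) (\<lambda>v. Max ((\<lambda>d. (v \<bullet> d) / norm d) ` D))"
    unfolding divide_inverse by (intro continuous_on_Max_image assms continuous_intros)
  also have "?this \<longleftrightarrow> continuous_on (sphere 0 1) g"
    by (rule continuous_on_cong) (auto simp: g_def)
  finally have "continuous_on (sphere 0 1) g" .
  moreover have "sphere 0 1 \<noteq> ({} :: 'a set)"
    using vector_choose_size[of 1] by (metis dist_0_norm empty_iff mem_sphere zero_le_one)
  ultimately obtain v :: 'a where v: "v \<in> sphere 0 1" "\<forall>w\<in>sphere 0 1. g v \<le> g w"
    using continuous_attains_inf[of "sphere 0 1" g] by auto
  have le: "g v \<le> g w" if "w \<noteq> 0" for w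
  proof -
    have "g (w /\<^sub>R norm w) = g w"
      using that by (simp add: g_def divide_simps mult.commute)
    then show ?thesis using v(2) that by (auto dest!: bspec[of _ _ "w /\<^sub>R norm w"])
  qed
  have "v \<noteq> 0" using v(1) by auto
  then have "(INF w\<in>-{0}. g w) = g v"
    by (intro cInf_eq_minimum) (auto intro: le)
  then have "cosine_measure D = g v" by (simp add: cosine_measure_def g_def)
  with \<open>v \<noteq> 0\<close> le show ?thesis by (intro that[of v]) (auto simp: g_def)
qed

primrec sds_step_size :: "real \<Rightarrow> nat \<Rightarrow> real" where
  "sds_step_size \<alpha>0 0 = \<alpha>0"
| "sds_step_size \<alpha>0 (Suc k) = sds_step_size \<alpha>0 k / 2"

definition sufficient_decrease ::
  "('a::real_vector \<Rightarrow> real) \<Rightarrow> real \<Rightarrow> real \<Rightarrow> 'a \<Rightarrow> 'a \<Rightarrow> bool" where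
  "sufficient_decrease f c \<alpha> z d \<longleftrightarrow> f (z + \<alpha> *\<^sub>R d) \<le> f z - c * \<alpha>\<^sup>2"

text \<open>
  A run of Simplified Direct Search with outer iterates \<open>x k\<close>, inner iterates \<open>y k j\<close>,
  chosen directions \<open>d k j\<close> and numbers \<open>l k\<close> of successful inner steps.
  Termination of the inner loops is not built in: \<open>l k = \<infinity>\<close> means that the
  \<open>k\<close>-th inner loop runs forever, in which case \<open>x k\<close> (and so everything after it)
  carries no meaning and is unconstrained. The choice of directions is arbitrary
  among those giving sufficient decrease.
\<close>

definition sds_run ::
  "('a::real_vector \<Rightarrow> real) \<Rightarrow> 'a \<Rightarrow> real \<Rightarrow> real \<Rightarrow> 'a set \<Rightarrow>
   (nat \<Rightarrow> 'a) \<Rightarrow> (nat \<Rightarrow> nat \<Rightarrow> 'a) \<Rightarrow> (nat \<Rightarrow> nat \<Rightarrow> 'a) \<Rightarrow> (nat \<Rightarrow> enat) \<Rightarrow> bool" where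
  "sds_run f x0 \<alpha>0 c D x y d l \<longleftrightarrow>
     x 0 = x0 \<and>
     (\<forall>k\<ge>1.
        y k 0 = x (k - 1) \<and>
        (\<forall>j. enat j < l k \<longrightarrow>
           d k j \<in> D \<and> sufficient_decrease f c (sds_step_size \<alpha>0 k) (y k j) (d k j) \<and>
           y k (Suc j) = y k j + sds_step_size \<alpha>0 k *\<^sub>R d k j) \<and>
        (\<forall>j. l k = enat j \<longrightarrow>
           (\<forall>e\<in>D. \<not> sufficient_decrease f c (sds_step_size \<alpha>0 k) (y k j) e) \<and>
           x k = y k j))"

text \<open>
  Worst-case numbers of function evaluations: each of the \<open>l k\<close> successful inner steps and the
  final unsuccessful one costs at most \<open>card D\<close> evaluations, and evaluating \<open>f x0\<close> costs one.
  These are meaningful only for finite \<open>l k\<close>.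
\<close>

definition sds_iteration_evals :: "'a set \<Rightarrow> (nat \<Rightarrow> enat) \<Rightarrow> nat \<Rightarrow> nat" where
  "sds_iteration_evals D l k = card D * (the_enat (l k) + 1)"

definition sds_total_evals :: "'a set \<Rightarrow> (nat \<Rightarrow> enat) \<Rightarrow> nat \<Rightarrow> nat" where
  "sds_total_evals D l k = 1 + (\<Sum>j=1..k. sds_iteration_evals D l j)"

end

theory Submission
  imports Defs
begin

text \<open>
  If no direction of \<open>D\<close> gives sufficient decrease at step size \<open>\<alpha>\<close>, then the descent lemma bounds
  \<open>- grad z \<bullet> e\<close> by \<open>(L / 2 + c) * \<alpha>\<close> for all \<open>e\<close> in \<open>D\<close>, and the direction best aligned with
  \<open>- grad z\<close> turns this into a bound on \<open>norm (grad z)\<close>. Strong convexity converts the gradient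
  bound into bounds on the function gap and on the distance to the minimizer. Each inner loop
  starts at a point where the previous, doubled step size was unsuccessful, so the gap there is
  at most \<open>4 * S * \<alpha>\<^sup>2\<close>; as each inner step lowers \<open>f\<close> by at least \<open>c * \<alpha>\<^sup>2\<close>, at most \<open>4 * S / c\<close>
  of them can occur.
\<close>

section \<open>Positive spanning sets and the cosine measure\<close>

text \<open>Expanding \<open>v\<close> as a nonnegative combination of \<open>D\<close> turns
  \<open>v \<bullet> v > 0\<close> into a sum, which must have a positive term.\<close>

lemma positive_spanning_set_inner_pos:
  fixes v :: "'a::euclidean_space"
  assumes "positive_spanning_set D" "v \<noteq> 0"
  obtains e where "e \<in> D" "v \<bullet> e > 0"
proof -
  have "v \<in> {\<Sum>d\<in>D. t d *\<^sub>R d | t. \<forall>d\<in>D. (t d :: real) \<ge> 0}"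
    using assms(1) by (auto simp: positive_spanning_set_def)
  then obtain t where t: "v = (\<Sum>d\<in>D. t d *\<^sub>R d)" "\<forall>d\<in>D. (t d :: real) \<ge> 0"
    by blast
  have "v \<bullet> v = (\<Sum>d\<in>D. t d * (v \<bullet> d))"
    by (subst (2) t(1)) (simp add: inner_sum_right)
  with assms(2) have "(\<Sum>d\<in>D. t d * (v \<bullet> d)) > 0" by (metis inner_gt_zero_iff)
  then have "\<not> (\<forall>d\<in>D. t d * (v \<bullet> d) \<le> 0)"
    using sum_nonpos[of D "\<lambda>d. t d * (v \<bullet> d)"] by fastforce
  then obtain e where "e \<in> D" "t e * (v \<bullet> e) > 0"
    by (auto simp: not_le)
  with t(2) that show ?thesis by (auto simp: zero_less_mult_iff dest!: bspec)
qed

lemma positive_spanning_set_nonempty: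
  fixes D :: "'a::euclidean_space set"
  assumes "positive_spanning_set D"
  shows "D \<noteq> {}"
proof -
  obtain b :: 'a where "b \<noteq> 0" using nonzero_Basis SOME_Basis by blast
  then show ?thesis using positive_spanning_set_inner_pos[OF assms] by blast
qed

text \<open>Since the minimum is attained, it suffices that one minimizing \<open>v\<close> has a
  positive inner product with a member of \<open>D\<close>; pointwise positivity alone would not
  keep an infimum away from zero.\<close>

lemma cosine_measure_pos:
  fixes D :: "'a::euclidean_space set"
  assumes "positive_spanning_set D"
  shows "cosine_measure D > 0"
proof -
  have fin: "finite D" using assms by (simp add: positive_spanning_set_def)
  obtain v where v: "v \<noteq> 0"
    "cosine_measure D = Max ((\<lambda>d. (v \<bullet> d) / (norm v * norm d)) ` D)"
    using cosine_measure_is_minimum[OF fin positive_spanning_set_nonempty[OF assms]] by metis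
  obtain e where e: "e \<in> D" "v \<bullet> e > 0"
    using positive_spanning_set_inner_pos[OF assms v(1)] .
  then have "e \<noteq> 0" by auto
  with v(1) e(2) have "0 < (v \<bullet> e) / (norm v * norm e)" by simp
  also have "\<dots> \<le> cosine_measure D" unfolding v(2) using fin e(1) by (intro Max_ge) auto
  finally show ?thesis .
qed

text \<open>The maximum over \<open>D\<close> is attained at some \<open>e\<close>; clearing the
  denominator, with \<open>norm e = 1\<close>, gives a form that also covers
  \<open>w = 0\<close>.\<close>

lemma cosine_measure_direction:
  fixes D :: "'a::euclidean_space set"
  assumes "positive_spanning_set D" "\<And>e. e \<in> D \<Longrightarrow> norm e = 1"
  obtains e where "e \<in> D" "cosine_measure D * norm w \<le> w \<bullet> e"
proof (cases "w = 0")
  case True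
  with positive_spanning_set_nonempty[OF assms(1)] that show ?thesis by auto
next
  case False
  have fin: "finite D" using assms(1) by (simp add: positive_spanning_set_def)
  have ne: "D \<noteq> {}" using assms(1) by (rule positive_spanning_set_nonempty)
  let ?A = "(\<lambda>d. (w \<bullet> d) / (norm w * norm d)) ` D"
  have "Max ?A \<in> ?A" using fin ne by (intro Max_in) auto
  then obtain e where e: "e \<in> D" "Max ?A = (w \<bullet> e) / (norm w * norm e)" by auto
  have "cosine_measure D \<le> Max ?A"
    using cosine_measure_is_minimum[OF fin ne] False by metis
  with e assms(2) False have "cosine_measure D * norm w \<le> w \<bullet> e"
    by (simp add: pos_le_divide_eq)
  with e(1) that show ?thesis by blast
qed

section \<open>Smoothness and unsuccessful steps\<close>

lemma descent_lemma:
  fixes f :: "'a::real_inner \<Rightarrow> real"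
  assumes grad: "\<And>z. GDERIV f z :> grad z"
    and lip: "\<And>z w. norm (grad z - grad w) \<le> L * norm (z - w)"
  shows "f (z + h) \<le> f z + grad z \<bullet> h + L / 2 * (norm h)\<^sup>2"
proof -
  \<comment> \<open>Up to the constant \<open>f z\<close>, this is \<open>f\<close> minus its
    quadratic upper model along the segment. The claim is \<open>\<phi> 1 \<le> \<phi> 0\<close>,
    and the Lipschitz bound with Cauchy-Schwarz makes the derivative nonpositive.\<close>
  define \<phi> where "\<phi> t = f (z + t *\<^sub>R h) - t * (grad z \<bullet> h) - L / 2 * t\<^sup>2 * (norm h)\<^sup>2" for t :: real
  have deriv: "(\<phi> has_real_derivative
      (grad (z + t *\<^sub>R h) - grad z) \<bullet> h - L * t * (norm h)\<^sup>2) (at t)" for t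
  proof -
    have "((\<lambda>t. f (z + t *\<^sub>R h)) has_derivative (\<lambda>s. s *\<^sub>R h \<bullet> grad (z + t *\<^sub>R h))) (at t)"
      by (rule has_derivative_compose[of "\<lambda>t. z + t *\<^sub>R h" _ _ _ f, OF _ grad[unfolded gderiv_def]])
        (auto intro!: derivative_eq_intros)
    moreover have "(\<lambda>s. s *\<^sub>R h \<bullet> grad (z + t *\<^sub>R h)) = (*) (grad (z + t *\<^sub>R h) \<bullet> h)"
      by (intro ext) (simp add: inner_commute)
    ultimately have "((\<lambda>t. f (z + t *\<^sub>R h)) has_real_derivative grad (z + t *\<^sub>R h) \<bullet> h) (at t)"
      by (simp only: has_field_derivative_def)
    then show ?thesis
      unfolding \<phi>_def
      by (auto intro!: derivative_eq_intros simp: inner_diff_left)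
  qed
  have "(grad (z + t *\<^sub>R h) - grad z) \<bullet> h \<le> L * t * (norm h)\<^sup>2" if "t \<ge> 0" for t
  proof -
    have "(grad (z + t *\<^sub>R h) - grad z) \<bullet> h \<le> norm (grad (z + t *\<^sub>R h) - grad z) * norm h"
      by (rule norm_cauchy_schwarz)
    also have "\<dots> \<le> (L * norm (z + t *\<^sub>R h - z)) * norm h"
      by (intro mult_right_mono lip) simp
    finally show ?thesis using that by (simp add: power2_eq_square mult.assoc)
  qed
  then have nonpos: "(grad (z + t *\<^sub>R h) - grad z) \<bullet> h - L * t * (norm h)\<^sup>2 \<le> 0" if "t \<ge> 0" for t
    using that by (simp only: diff_le_0_iff_le)
  have "\<phi> 1 \<le> \<phi> 0"
  proof (rule DERIV_nonpos_imp_nonincreasing[where f = \<phi>])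
    fix t :: real
    assume "0 \<le> t"
    then show "\<exists>s. (\<phi> has_real_derivative s) (at t) \<and> s \<le> 0"
      using deriv nonpos by blast
  qed simp
  then show ?thesis by (simp add: \<phi>_def)
qed

lemma unsuccessful_imp_norm_grad_le:
  fixes f :: "'a::euclidean_space \<Rightarrow> real"
  assumes grad: "\<And>z. GDERIV f z :> grad z"
    and lip: "\<And>z w. norm (grad z - grad w) \<le> L * norm (z - w)"
    and D: "positive_spanning_set D" "\<And>e. e \<in> D \<Longrightarrow> norm e = 1"
    and "\<alpha> > 0"
    and fail: "\<And>e. e \<in> D \<Longrightarrow> \<not> sufficient_decrease f c \<alpha> z e"
  shows "norm (grad z) \<le> (L / 2 + c) * \<alpha> / cosine_measure D"
proof -
  obtain e where e: "e \<in> D" "cosine_measure D * norm (- grad z) \<le> - grad z \<bullet> e"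
    using cosine_measure_direction[OF D] .
  have "f z - c * \<alpha>\<^sup>2 < f (z + \<alpha> *\<^sub>R e)"
    using fail[OF e(1)] by (simp add: sufficient_decrease_def)
  also have "\<dots> \<le> f z + grad z \<bullet> (\<alpha> *\<^sub>R e) + L / 2 * (norm (\<alpha> *\<^sub>R e))\<^sup>2"
    by (rule descent_lemma[OF grad lip])
  \<comment> \<open>As \<open>e\<close> has unit norm, the quadratic term is \<open>L / 2\<close>
    times the square of \<alpha>, so one factor \<alpha> can be cancelled.\<close>
  finally have "\<alpha> * (- grad z \<bullet> e) < \<alpha> * ((L / 2 + c) * \<alpha>)"
    using D(2)[OF e(1)] by (simp add: algebra_simps power2_eq_square)
  with \<open>\<alpha> > 0\<close> have "- grad z \<bullet> e < (L / 2 + c) * \<alpha>"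
    by (simp only: mult_less_cancel_left_pos)
  with e(2) have "cosine_measure D * norm (grad z) \<le> (L / 2 + c) * \<alpha>" by simp
  then show ?thesis
    using cosine_measure_pos[OF D(1)] by (simp add: pos_le_divide_eq mult.commute)
qed

section \<open>Consequences of strong convexity\<close>

lemma strongly_convex_gap_le:
  fixes f :: "'a::real_inner \<Rightarrow> real"
  assumes "lam > 0" "f w \<ge> f z + g \<bullet> (w - z) + lam / 2 * (norm (w - z))\<^sup>2"
  shows "f z - f w \<le> (norm g)\<^sup>2 / (2 * lam)"
proof -
  \<comment> \<open>The quadratic lower model at \<open>z\<close> is least where this vector
    vanishes; expanding its squared norm completes the square.\<close>
  have "0 \<le> (norm (g + lam *\<^sub>R (w - z)))\<^sup>2" by simp
  also have "\<dots> = (norm g)\<^sup>2 + 2 * lam * (g \<bullet> (w - z) + lam / 2 * (norm (w - z))\<^sup>2)"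
    unfolding power2_norm_eq_inner inner_add_left inner_add_right
    by (simp add: inner_commute algebra_simps power2_eq_square)
  also have "\<dots> \<le> (norm g)\<^sup>2 + 2 * lam * (f w - f z)"
    using assms by (intro add_left_mono mult_left_mono) auto
  finally show ?thesis using assms(1) by (simp add: field_simps)
qed

lemma strongly_convex_dist_le:
  fixes f :: "'a::real_inner \<Rightarrow> real"
  assumes grad: "\<And>z. GDERIV f z :> grad z"
    and "lam > 0"
    and conv: "\<And>z w. f w \<ge> f z + grad z \<bullet> (w - z) + lam / 2 * (norm (w - z))\<^sup>2"
    and min: "\<And>z. f xstar \<le> f z"
  shows "norm (z - xstar) \<le> norm (grad z) / lam"
proof -
  have "(\<lambda>h. h \<bullet> grad xstar) = (\<lambda>h. 0)"
    by (rule has_derivative_local_min[OF grad[unfolded gderiv_def]]) (simp add: min)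
  then have "grad xstar \<bullet> grad xstar = 0" by metis
  then have "grad xstar = 0" by simp
  with conv[of xstar z] have "f xstar + lam / 2 * (norm (z - xstar))\<^sup>2 \<le> f z" by simp
  moreover have "f z - grad z \<bullet> (z - xstar) + lam / 2 * (norm (z - xstar))\<^sup>2 \<le> f xstar"
    using conv[of z xstar] by (simp add: inner_diff_right norm_minus_commute)
  \<comment> \<open>Adding the inequalities based at \<open>xstar\<close> and at \<open>z\<close>
    yields the factor \<open>lam\<close>; using only the one at \<open>z\<close> with minimality
    would leave \<open>lam / 2\<close>.\<close>
  ultimately have "lam * (norm (z - xstar))\<^sup>2 \<le> grad z \<bullet> (z - xstar)" by simp
  also have "\<dots> \<le> norm (grad z) * norm (z - xstar)" by (rule norm_cauchy_schwarz)
  finally have "(lam * norm (z - xstar)) * norm (z - xstar) \<le> norm (grad z) * norm (z - xstar)"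
    by (simp add: power2_eq_square mult.assoc)
  then have "lam * norm (z - xstar) \<le> norm (grad z)"
    by (cases "z = xstar") auto
  with \<open>lam > 0\<close> show ?thesis by (simp add: pos_le_divide_eq mult.commute)
qed

section \<open>Runs of the direct search\<close>

lemma sds_step_size_eq: "sds_step_size \<alpha>0 k = \<alpha>0 / 2 ^ k"
  by (induction k) auto

text \<open>The decreases telescope. The hypothesis admits the final point \<open>j = l k\<close>,
  and every \<open>j\<close> if the loop never stops.\<close>

lemma sds_inner_decrease:
  assumes run: "sds_run f x0 \<alpha>0 c D x y d l" and "k \<ge> 1" and "enat j \<le> l k"
  shows "f (y k j) \<le> f (x (k - 1)) - real j * (c * (sds_step_size \<alpha>0 k)\<^sup>2)"
  using \<open>enat j \<le> l k\<close>
proof (induction j)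
  case 0
  then show ?case using run \<open>k \<ge> 1\<close> by (simp add: sds_run_def)
next
  case (Suc j)
  then have less: "enat j < l k" by (metis Suc_ile_eq)
  with run \<open>k \<ge> 1\<close> have "f (y k (Suc j)) \<le> f (y k j) - c * (sds_step_size \<alpha>0 k)\<^sup>2"
    by (simp add: sds_run_def sufficient_decrease_def)
  moreover have "f (y k j) \<le> f (x (k - 1)) - real j * (c * (sds_step_size \<alpha>0 k)\<^sup>2)"
    using Suc.IH less by simp
  ultimately show ?case by (simp add: algebra_simps)
qed

text \<open>The bound applies to every step count reached, so it gives termination as well as the
  estimate for \<open>l k\<close>.\<close>

lemma sds_inner_steps_bounded:
  assumes run: "sds_run f x0 \<alpha>0 c D x y d l" and "k \<ge> 1"
    and "c > 0" and "\<alpha>0 > 0" and lower: "\<And>z. m \<le> f z"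
    and gap: "f (x (k - 1)) - m \<le> S * (sds_step_size \<alpha>0 (k - 1))\<^sup>2"
  obtains j where "l k = enat j" "real j \<le> 4 * S / c"
proof -
  \<comment> \<open>Squaring this factor 2 produces the 4 in \<open>4 * S / c\<close>.\<close>
  have step: "sds_step_size \<alpha>0 (k - 1) = 2 * sds_step_size \<alpha>0 k"
    using \<open>k \<ge> 1\<close> by (cases k) auto
  have bound: "real j \<le> 4 * S / c" if "enat j \<le> l k" for j
  proof -
    have "real j * (c * (sds_step_size \<alpha>0 k)\<^sup>2) \<le> f (x (k - 1)) - m"
      using sds_inner_decrease[OF run \<open>k \<ge> 1\<close> that] lower[of "y k j"] by linarith
    also have "\<dots> \<le> 4 * S * (sds_step_size \<alpha>0 k)\<^sup>2"
      using gap unfolding step by (simp add: power_mult_distrib)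
    finally have "(real j * c) * (sds_step_size \<alpha>0 k)\<^sup>2 \<le> (4 * S) * (sds_step_size \<alpha>0 k)\<^sup>2"
      by (simp add: mult.assoc)
    moreover have "(sds_step_size \<alpha>0 k)\<^sup>2 > 0"
      using \<open>\<alpha>0 > 0\<close> by (simp add: sds_step_size_eq)
    ultimately have "real j * c \<le> 4 * S" by (simp only: mult_le_cancel_right_pos)
    with \<open>c > 0\<close> show ?thesis by (simp add: pos_le_divide_eq)
  qed
  show ?thesis
  proof (cases "l k")
    case (enat j)
    with bound[of j] that show ?thesis by simp
  next
    case infinity
    obtain j where "4 * S / c < real j" using reals_Archimedean2 by blast
    with bound[of j] infinity show ?thesis by simp
  qed
qed

text \<open>A run constrains \<open>x k\<close> only if the inner loop stops, so termination and
  failure are proved together: failure at \<open>k\<close> gives the gap, the gap stops the next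
  loop, and stopping means failure at \<open>Suc k\<close>.\<close>

lemma sds_unsuccessful:
  assumes run: "sds_run f x0 \<alpha>0 c D x y d l"
    and "c > 0" and "\<alpha>0 > 0" and lower: "\<And>z. m \<le> f z"
    and start: "\<And>e. e \<in> D \<Longrightarrow> \<not> sufficient_decrease f c \<alpha>0 x0 e"
    and gap: "\<And>\<alpha> z. \<alpha> > 0 \<Longrightarrow> (\<And>e. e \<in> D \<Longrightarrow> \<not> sufficient_decrease f c \<alpha> z e) \<Longrightarrow>
      f z - m \<le> S * \<alpha>\<^sup>2"
    and "e \<in> D"
  shows "\<not> sufficient_decrease f c (sds_step_size \<alpha>0 k) (x k) e"
  using \<open>e \<in> D\<close>
\<comment> \<open>The hypothesis \<open>gap\<close> needs failure in all directions, hence the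
  generalization over \<open>e\<close>.\<close>
proof (induction k arbitrary: e)
  case 0
  then show ?case using run start by (simp add: sds_run_def)
next
  case (Suc k)
  have "f (x k) - m \<le> S * (sds_step_size \<alpha>0 k)\<^sup>2"
    using \<open>\<alpha>0 > 0\<close> Suc.IH by (intro gap) (auto simp: sds_step_size_eq)
  then obtain j where "l (Suc k) = enat j"
    using sds_inner_steps_bounded[OF run _ \<open>c > 0\<close> \<open>\<alpha>0 > 0\<close> lower, of "Suc k" S] by auto
  moreover have "\<forall>j. l (Suc k) = enat j \<longrightarrow>
      (\<forall>e\<in>D. \<not> sufficient_decrease f c (sds_step_size \<alpha>0 (Suc k)) (y (Suc k) j) e) \<and>
      x (Suc k) = y (Suc k) j"
    using run unfolding sds_run_def by (metis le_add1 plus_1_eq_Suc)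
  ultimately show ?case using Suc.prems by metis
qed

section \<open>Evaluation counts and the target accuracy\<close>

lemma sds_total_evals_le:
  assumes "\<And>j. j \<ge> 1 \<Longrightarrow> real (sds_iteration_evals D l j) \<le> B"
  shows "real (sds_total_evals D l k) \<le> 1 + B * real k"
proof -
  have "(\<Sum>j=1..k. real (sds_iteration_evals D l j)) \<le> (\<Sum>j=1..k. B)"
    using assms by (intro sum_mono) simp
  then show ?thesis by (simp add: sds_total_evals_def mult.commute)
qed

lemma halving_reaches_tolerance:
  assumes "0 < a" "0 < S" "0 < \<epsilon>" "\<epsilon> < S * a\<^sup>2" "k = nat \<lceil>log 2 (a * sqrt (S / \<epsilon>))\<rceil>"
  shows "S * (a / 2 ^ k)\<^sup>2 \<le> \<epsilon>" "real k \<le> 1 + log 2 (a * sqrt (S / \<epsilon>))"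
proof -
  let ?q = "a * sqrt (S / \<epsilon>)"
  have sq: "?q\<^sup>2 = S * a\<^sup>2 / \<epsilon>" using assms by (simp add: power_mult_distrib)
  have q0: "?q > 0" using assms by simp
  \<comment> \<open>Here \<open>\<epsilon> < S * a\<^sup>2\<close> enters: the logarithm is
    positive, so \<open>nat\<close> truncates nothing and rounding up costs at most 1.\<close>
  have "1\<^sup>2 < ?q\<^sup>2" unfolding sq using assms by simp
  then have "1 < ?q" using q0 by (metis less_imp_le power2_less_imp_less)
  then have "log 2 ?q > 0" by simp
  then show "real k \<le> 1 + log 2 ?q" using assms(5) by linarith
  have "log 2 ?q \<le> real k" using assms(5) real_nat_ceiling_ge by blast
  then have "?q \<le> 2 ^ k" using q0 by (simp add: log_le_iff powr_realpow)
  then have "?q\<^sup>2 \<le> (2 ^ k)\<^sup>2" using q0 by (intro power_mono) auto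
  then show "S * (a / 2 ^ k)\<^sup>2 \<le> \<epsilon>"
    unfolding sq using assms by (simp add: power_divide field_simps)
qed

text \<open>Finiteness of \<open>l k\<close> belongs to the conclusion because
  \<open>the_enat\<close> gives the evaluation counts their meaning only for loops that
  stop.\<close>

theorem theorem13:
  fixes f :: "real ^ 'n \<Rightarrow> real"
    and grad :: "real ^ 'n \<Rightarrow> real ^ 'n"
    and L lam c \<alpha>0 \<mu> S :: real
    and D :: "(real ^ 'n) set"
    and x0 xstar :: "real ^ 'n"
    and x :: "nat \<Rightarrow> real ^ 'n"
    and y d :: "nat \<Rightarrow> nat \<Rightarrow> real ^ 'n"
    and l :: "nat \<Rightarrow> enat"
  assumes "\<And>z. GDERIV f z :> grad z"
    and "L > 0" and "\<And>z w. norm (grad z - grad w) \<le> L * norm (z - w)"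
    and "lam > 0"
    and "\<And>z w. f w \<ge> f z + grad z \<bullet> (w - z) + lam / 2 * (norm (w - z))\<^sup>2"
    and "is_arg_min f (\<lambda>_. True) xstar"
    and "positive_spanning_set D" and "\<And>e. e \<in> D \<Longrightarrow> norm e = 1"
    and "\<mu> = cosine_measure D"
    and "\<alpha>0 > 0" and "c > 0"
    and "\<And>e. e \<in> D \<Longrightarrow> f (x0 + \<alpha>0 *\<^sub>R e) > f x0 - c * \<alpha>0\<^sup>2"
    and "S = (L / 2 + c)\<^sup>2 / (2 * lam * \<mu>\<^sup>2)"
    and "sds_run f x0 \<alpha>0 c D x y d l"
  shows "(\<forall>k.
            norm (grad (x k)) \<le> (L / 2 + c) * \<alpha>0 / (2 ^ k * \<mu>) \<and>
            f (x k) - f xstar \<le> S * (\<alpha>0 / 2 ^ k)\<^sup>2 \<and>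
            norm (x k - xstar) \<le> (L / 2 + c) * \<alpha>0 / (2 ^ k * \<mu> * lam)) \<and>
         (\<forall>k\<ge>1.
            l k \<noteq> \<infinity> \<and>
            real (sds_iteration_evals D l k) \<le> real (card D) * (4 * S / c + 1)) \<and>
         (\<forall>\<epsilon> k. 0 < \<epsilon> \<and> \<epsilon> < S * \<alpha>0\<^sup>2 \<and> k = nat \<lceil>log 2 (\<alpha>0 * sqrt (S / \<epsilon>))\<rceil> \<longrightarrow>
            f (x k) - f xstar \<le> \<epsilon> \<and>
            real (sds_total_evals D l k)
              \<le> 1 + real (card D) * (4 * S / c + 1) * (1 + log 2 (\<alpha>0 * sqrt (S / \<epsilon>))))"
proof -
  note grad = assms(1) and lip = assms(3) and conv = assms(5) and D = assms(7,8)
    and run = assms(14)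
  have \<mu>: "\<mu> > 0" using cosine_measure_pos[OF D(1)] assms(9) by simp
  have S: "S > 0" using assms(2,4,11,13) \<mu> by (simp add: add_pos_pos)
  have min: "f xstar \<le> f z" for z
    using assms(6) by (simp add: is_arg_min_def not_less)
  have norm_grad: "norm (grad z) \<le> (L / 2 + c) * \<alpha> / \<mu>"
    if "\<alpha> > 0" "\<And>e. e \<in> D \<Longrightarrow> \<not> sufficient_decrease f c \<alpha> z e" for \<alpha> z
    unfolding assms(9) by (rule unsuccessful_imp_norm_grad_le[OF grad lip D that])
  \<comment> \<open>Stated for arbitrary points and step sizes, since the induction over the run
    takes it as a hypothesis. \<open>S\<close> is the squared gradient bound over
    \<open>2 * lam\<close>, without the step size.\<close>
  have gap: "f z - f xstar \<le> S * \<alpha>\<^sup>2"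
    if "\<alpha> > 0" "\<And>e. e \<in> D \<Longrightarrow> \<not> sufficient_decrease f c \<alpha> z e" for \<alpha> z
  proof -
    have "f z - f xstar \<le> (norm (grad z))\<^sup>2 / (2 * lam)"
      using assms(4) conv by (rule strongly_convex_gap_le)
    also have "\<dots> \<le> ((L / 2 + c) * \<alpha> / \<mu>)\<^sup>2 / (2 * lam)"
      using norm_grad[OF that] assms(4) by (intro divide_right_mono power_mono) auto
    also have "\<dots> = S * \<alpha>\<^sup>2"
      by (simp add: assms(13) power_mult_distrib power_divide)
    finally show ?thesis .
  qed
  have fail: "\<not> sufficient_decrease f c (sds_step_size \<alpha>0 k) (x k) e" if "e \<in> D" for k e
    by (rule sds_unsuccessful[OF run assms(11,10) min _ gap that])
      (use assms(12) in \<open>force simp: sufficient_decrease_def\<close>)+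
  have pos: "sds_step_size \<alpha>0 k > 0" for k using assms(10) by (simp add: sds_step_size_eq)
  have gap_x: "f (x k) - f xstar \<le> S * (sds_step_size \<alpha>0 k)\<^sup>2" for k
    using gap[OF pos fail] .
  have grad_x: "norm (grad (x k)) \<le> (L / 2 + c) * \<alpha>0 / (2 ^ k * \<mu>)" for k
    using norm_grad[OF pos fail, of k] by (simp add: sds_step_size_eq)
  have dist_x: "norm (x k - xstar) \<le> (L / 2 + c) * \<alpha>0 / (2 ^ k * \<mu> * lam)" for k
  proof -
    have "norm (x k - xstar) \<le> norm (grad (x k)) / lam"
      by (rule strongly_convex_dist_le[OF grad assms(4) conv min])
    also have "\<dots> \<le> (L / 2 + c) * \<alpha>0 / (2 ^ k * \<mu>) / lam"
      using grad_x assms(4) by (intro divide_right_mono) auto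
    finally show ?thesis by (simp add: mult.assoc)
  qed
  have iter: "l k \<noteq> \<infinity> \<and> real (sds_iteration_evals D l k) \<le> real (card D) * (4 * S / c + 1)"
    if k: "k \<ge> 1" for k
  proof -
    obtain j where j: "l k = enat j" "real j \<le> 4 * S / c"
      using sds_inner_steps_bounded[OF run k assms(11,10) min gap_x] .
    have "real (card D) * (real j + 1) \<le> real (card D) * (4 * S / c + 1)"
      using j(2) by (intro mult_left_mono) auto
    with j(1) show ?thesis by (simp add: sds_iteration_evals_def algebra_simps)
  qed
  have "f (x k) - f xstar \<le> \<epsilon> \<and>
      real (sds_total_evals D l k)
        \<le> 1 + real (card D) * (4 * S / c + 1) * (1 + log 2 (\<alpha>0 * sqrt (S / \<epsilon>)))"
    if "0 < \<epsilon>" "\<epsilon> < S * \<alpha>0\<^sup>2" "k = nat \<lceil>log 2 (\<alpha>0 * sqrt (S / \<epsilon>))\<rceil>" for \<epsilon> k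
  proof
    note tol = halving_reaches_tolerance[OF assms(10) S that]
    show "f (x k) - f xstar \<le> \<epsilon>"
      using gap_x[of k] tol(1) by (simp add: sds_step_size_eq)
    have "real (sds_total_evals D l k) \<le> 1 + real (card D) * (4 * S / c + 1) * real k"
      using iter by (intro sds_total_evals_le) blast
    also have "\<dots> \<le> 1 + real (card D) * (4 * S / c + 1) * (1 + log 2 (\<alpha>0 * sqrt (S / \<epsilon>)))"
      \<comment> \<open>Positivity of \<open>S\<close> and \<open>c\<close> makes the factor in
        front of \<open>real k\<close> nonnegative.\<close>
      using tol(2) S assms(11) by (intro add_left_mono mult_left_mono) auto
    finally show "real (sds_total_evals D l k) \<le> \<dots>" .
  qed
  with gap_x grad_x dist_x iter show ?thesis by (auto simp: sds_step_size_eq)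
qed

end
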